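(* Let $E$ and $F$ be Banach spaces such that $F$ contains an isometric copy of $\ell_{q}$ for some $1\leq q<\infty$, and let $x_{0}$ be a norm-one vector in $E$. Then $\mathcal{N\!A}^{x_{0}}(E;F)$ is $c$-lineable.
   Context: Banach spaces are over a fixed scalar field $\mathbb{K}$, which is either $\mathbb{R}$ or $\mathbb{C}$. For a vector $x_0\in E$ with $\|x_0\|=1$ (a norm-one vector), a continuous linear operator $u\colon E\to F$ attains its norm at $x_0$ if $\|u(x_0)\|=\|u\|$. $\mathcal{N\!A}^{x_0}(E;F)$ denotes the set of all continuous linear operators from $E$ to $F$ that attain their norms at $x_0$. Let $c$ denote the cardinality of $\mathbb{R}$. A subset $A$ of a Banach (or quasi-Banach) space (here, the Banach space $\mathcal{L}(E;F)$ of continuous linear operators from $E$ to $F$) is $c$-lineable if $A\cup\{0\}$ contains a linear subspace of (algebraic) dimension $c$. *)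

theory Defs
  imports "HOL-Analysis.Analysis" "HOL-Library.Equipollence"
begin

text \<open>
  The scalar field is a type that is isometrically isomorphic, as a real normed algebra, to
  one of the two subfields \<^term>\<open>\<real>\<close> and \<^term>\<open>UNIV\<close> of the complex numbers.
\<close>

class real_or_complex = real_normed_field +
  assumes real_or_complex:
    "\<exists>\<phi>::'a \<Rightarrow> complex.
       (\<forall>a b. \<phi> (a + b) = \<phi> a + \<phi> b) \<and> (\<forall>a b. \<phi> (a * b) = \<phi> a * \<phi> b) \<and>
       (\<forall>r a. \<phi> (r *\<^sub>R a) = r *\<^sub>R \<phi> a) \<and> (\<forall>a. norm (\<phi> a) = norm a) \<and>
       (range \<phi> = \<real> \<or> range \<phi> = UNIV)"

instance real :: real_or_complex
proof
  show "\<exists>\<phi>::real \<Rightarrow> complex.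
       (\<forall>a b. \<phi> (a + b) = \<phi> a + \<phi> b) \<and> (\<forall>a b. \<phi> (a * b) = \<phi> a * \<phi> b) \<and>
       (\<forall>r a. \<phi> (r *\<^sub>R a) = r *\<^sub>R \<phi> a) \<and> (\<forall>a. norm (\<phi> a) = norm a) \<and>
       (range \<phi> = \<real> \<or> range \<phi> = UNIV)"
    by (rule exI[of _ complex_of_real]) (auto simp: scaleR_conv_of_real Reals_def)
qed

instance complex :: real_or_complex
proof
  show "\<exists>\<phi>::complex \<Rightarrow> complex.
       (\<forall>a b. \<phi> (a + b) = \<phi> a + \<phi> b) \<and> (\<forall>a b. \<phi> (a * b) = \<phi> a * \<phi> b) \<and>
       (\<forall>r a. \<phi> (r *\<^sub>R a) = r *\<^sub>R \<phi> a) \<and> (\<forall>a. norm (\<phi> a) = norm a) \<and>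
       (range \<phi> = \<real> \<or> range \<phi> = UNIV)"
    by (rule exI[of _ id]) auto
qed

text \<open>
  The class \<^class>\<open>banach\<close> only provides the underlying real Banach space. The
  scalar multiplication by \<open>'k\<close> is explicit and extends the one by the reals; for
  \<open>'k = real\<close> it is \<^term>\<open>scaleR\<close>.
\<close>

locale banach_over = vector_space scale
  for scale :: "'k::real_or_complex \<Rightarrow> 'e::banach \<Rightarrow> 'e" +
  assumes norm_scale: "norm (scale a x) = norm a * norm x"
    and scale_of_real: "scale (of_real r) x = r *\<^sub>R x"

lemma banach_over_scaleR: "banach_over (scaleR :: real \<Rightarrow> 'e::banach \<Rightarrow> 'e)"
  by unfold_locales (auto simp: algebra_simps)

definition lq :: "real \<Rightarrow> (nat \<Rightarrow> 'k::real_or_complex) set" where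
  "lq q = {x. summable (\<lambda>n. norm (x n) powr q)}"

definition lq_norm :: "real \<Rightarrow> (nat \<Rightarrow> 'k::real_or_complex) \<Rightarrow> real" where
  "lq_norm q x = (\<Sum>n. norm (x n) powr q) powr (1 / q)"

definition contains_isometric_copy_lq ::
    "('k::real_or_complex \<Rightarrow> 'f::banach \<Rightarrow> 'f) \<Rightarrow> real \<Rightarrow> bool" where
  "contains_isometric_copy_lq scaleF q \<longleftrightarrow>
     (\<exists>T :: (nat \<Rightarrow> 'k) \<Rightarrow> 'f.
        (\<forall>x\<in>lq q. \<forall>y\<in>lq q. T (\<lambda>n. x n + y n) = T x + T y) \<and>
        (\<forall>a. \<forall>x\<in>lq q. T (\<lambda>n. a * x n) = scaleF a (T x)) \<and>
        (\<forall>x\<in>lq q. norm (T x) = lq_norm q x))"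

text \<open>
  Elements of \<^typ>\<open>'e \<Rightarrow>\<^sub>L 'f\<close> are the continuous operators that are linear over the reals,
  so linearity over \<open>'k\<close> is an additional condition. Scalars of \<open>'k\<close> act through the target space.
\<close>

definition norm_attaining_at ::
    "('k::real_or_complex \<Rightarrow> 'e::banach \<Rightarrow> 'e) \<Rightarrow> ('k \<Rightarrow> 'f::banach \<Rightarrow> 'f) \<Rightarrow> 'e
      \<Rightarrow> ('e \<Rightarrow>\<^sub>L 'f) set" where
  "norm_attaining_at scaleE scaleF x0 =
     {u. Vector_Spaces.linear scaleE scaleF (blinfun_apply u) \<and>
         norm (blinfun_apply u x0) = norm u}"

definition scale_blinfun ::
    "('k::real_or_complex \<Rightarrow> 'f::banach \<Rightarrow> 'f) \<Rightarrow> 'k \<Rightarrow> ('e::banach \<Rightarrow>\<^sub>L 'f) \<Rightarrow> ('e \<Rightarrow>\<^sub>L 'f)" where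
  "scale_blinfun scaleF a u = Blinfun (\<lambda>x. scaleF a (blinfun_apply u x))"

context banach_over
begin

lemma scale_scaleR: "scale a (r *\<^sub>R x) = r *\<^sub>R scale a x"
  by (metis scale_of_real scale_left_commute)

lemma blinfun_apply_scale_blinfun:
  fixes u :: "'d::banach \<Rightarrow>\<^sub>L 'e"
  shows "blinfun_apply (scale_blinfun scale a u) x = scale a (blinfun_apply u x)"
proof -
  have "bounded_linear (scale a)"
    by (rule bounded_linear_intro[where K = "norm a"])
      (auto simp: scale_right_distrib scale_scaleR norm_scale mult.commute)
  then have "bounded_linear (\<lambda>x. scale a (blinfun_apply u x))"
    by (rule bounded_linear_compose) (rule blinfun.bounded_linear_right)
  then show ?thesis
    by (simp add: scale_blinfun_def bounded_linear_Blinfun_apply)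
qed

lemma vector_space_scale_blinfun:
  "vector_space (scale_blinfun scale :: 'k \<Rightarrow> ('d::banach \<Rightarrow>\<^sub>L 'e) \<Rightarrow> _)"
  by unfold_locales
    (auto intro!: blinfun_eqI simp: blinfun_apply_scale_blinfun blinfun.add_left
      scale_right_distrib scale_left_distrib)

end

text \<open>
  The dimension is expressed by a basis, since \<^const>\<open>vector_space.dim\<close> is a natural number.
\<close>

definition (in vector_space) c_lineable :: "'b set \<Rightarrow> bool" where
  "c_lineable A \<longleftrightarrow>
     (\<exists>V. subspace V \<and> V \<subseteq> A \<union> {0} \<and>
        (\<exists>B. independent B \<and> span B = V \<and> B \<approx> (UNIV :: real set)))"

end

theory Submission
  imports Defs "HOL-Computational_Algebra.Polynomial"
begin

text \<open>
  Fix, by the Hahn--Banach theorem, a functional \<open>f\<close> on the domain with norm one and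
  \<open>\<bar>f x0\<bar> = 1\<close>. For every vector \<open>y\<close> of the target the rank-one operator \<open>x \<mapsto> f x \<cdot> y\<close> has norm
  \<open>\<parallel>y\<parallel>\<close>, and that is also the norm of its value at \<open>x0\<close>. So \<open>y \<mapsto> f \<otimes> y\<close> embeds the whole
  target space linearly into the operators that attain their norm at \<open>x0\<close>, and the theorem reduces
  to finding continuum many linearly independent vectors in the target.

  These come from the copy of \<open>\<ell>\<^sub>q\<close>: it contains the geometric sequences \<open>(r\<^sup>n)\<^sub>n\<close> with
  \<open>0 < r < 1\<close>. A linear relation \<open>\<Sum>r. c r \<cdot> r\<^sup>n = 0\<close> holding for all \<open>n\<close> says that the finitely
  supported functional \<open>p \<mapsto> \<Sum>r. c r \<cdot> p r\<close> kills every polynomial, and a polynomial vanishing at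
  all nodes but one shows that each coefficient is zero.

  The Hahn--Banach theorem is proved over the reals by a minimality argument: by Zorn's lemma every
  sublinear functional dominates a minimal one, and a minimal sublinear functional is linear,
  because tilting it along any direction makes it no larger and so leaves it unchanged. A complex
  functional is recovered from its real part \<open>g\<close> as \<open>g x - \<i> g (\<i> x)\<close>.
\<close>

section \<open>The real Hahn--Banach theorem\<close>

definition sublinear :: "('a::real_vector \<Rightarrow> real) \<Rightarrow> bool" where
  "sublinear p \<longleftrightarrow>
     (\<forall>x y. p (x + y) \<le> p x + p y) \<and> (\<forall>r x. 0 < r \<longrightarrow> p (r *\<^sub>R x) \<le> r * p x)"

lemma sublinear_add: "sublinear p \<Longrightarrow> p (x + y) \<le> p x + p y"
  by (simp add: sublinear_def)

lemma sublinear_scaleR: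
  assumes "sublinear p" and "0 \<le> r"
  shows "p (r *\<^sub>R x) = r * p x"
proof (cases "r = 0")
  case True
  have "p ((1/2) *\<^sub>R 0) \<le> (1/2) * p 0" "p (2 *\<^sub>R 0) \<le> 2 * p 0"
    using assms(1) unfolding sublinear_def by (meson zero_less_numeral half_gt_zero_iff zero_less_one)+
  then show ?thesis using True by simp
next
  case False
  with assms have "0 < r" by simp
  have "p (r *\<^sub>R x) \<le> r * p x"
    using assms(1) \<open>0 < r\<close> by (simp add: sublinear_def)
  moreover have "p (inverse r *\<^sub>R (r *\<^sub>R x)) \<le> inverse r * p (r *\<^sub>R x)"
    using assms(1) \<open>0 < r\<close> unfolding sublinear_def by (meson positive_imp_inverse_positive)
  then have "r * p x \<le> p (r *\<^sub>R x)"
    using \<open>0 < r\<close> by (simp add: field_simps)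
  ultimately show ?thesis by simp
qed

lemma sublinear_ge_minus: "sublinear p \<Longrightarrow> - p (- x) \<le> p x"
  using sublinear_add[of p x "- x"] sublinear_scaleR[of p 0 0] by simp

text \<open>
  The hypotheses are those of a family that is sublinear only up to a change of index. This covers
  both infima formed below: of a chain of sublinear functionals, and of the translates of one.
\<close>

lemma sublinear_INF:
  fixes P :: "'i \<Rightarrow> 'a::real_vector \<Rightarrow> real"
  assumes ne: "I \<noteq> {}"
    and bdd: "\<And>x. bdd_below ((\<lambda>i. P i x) ` I)"
    and add: "\<And>i j x y. i \<in> I \<Longrightarrow> j \<in> I \<Longrightarrow> \<exists>k\<in>I. P k (x + y) \<le> P i x + P j y"
    and scale: "\<And>i r x. i \<in> I \<Longrightarrow> 0 < r \<Longrightarrow> \<exists>k\<in>I. P k (r *\<^sub>R x) \<le> r * P i x"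
  shows "sublinear (\<lambda>x. INF i\<in>I. P i x)"
  unfolding sublinear_def
proof (intro conjI allI impI)
  have le: "(INF i\<in>I. P i x) \<le> b" if "\<exists>k\<in>I. P k x \<le> b" for x b
    using that bdd by (meson cINF_lower order_trans)
  show "(INF i\<in>I. P i (x + y)) \<le> (INF i\<in>I. P i x) + (INF i\<in>I. P i y)" for x y
  proof -
    have "(INF i\<in>I. P i (x + y)) - P j y \<le> (INF i\<in>I. P i x)" if "j \<in> I" for j
      using le[OF add[OF _ that]] by (intro cINF_greatest[OF ne]) (simp add: diff_le_eq)
    then have "(INF i\<in>I. P i (x + y)) - (INF i\<in>I. P i x) \<le> (INF i\<in>I. P i y)"
      by (intro cINF_greatest[OF ne]) (simp add: algebra_simps)
    then show ?thesis by simp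
  qed
  show "(INF i\<in>I. P i (r *\<^sub>R x)) \<le> r * (INF i\<in>I. P i x)" if "0 < r" for r x
  proof -
    have "(INF i\<in>I. P i (r *\<^sub>R x)) / r \<le> (INF i\<in>I. P i x)"
      using le[OF scale[OF _ that]] that
      by (intro cINF_greatest[OF ne]) (simp add: divide_le_eq mult.commute)
    then show ?thesis using that by (simp add: divide_le_eq mult.commute)
  qed
qed

text \<open>
  Tilting \<open>p\<close> along \<open>y\<close> yields the largest sublinear minorant of \<open>p\<close> that is linear on the line
  through \<open>y\<close> with value \<open>p y\<close> at \<open>y\<close>.
\<close>

definition tilt :: "'a::real_vector \<Rightarrow> ('a \<Rightarrow> real) \<Rightarrow> 'a \<Rightarrow> real" where
  "tilt y p x = (INF t\<in>{0..}. p (x + t *\<^sub>R y) - t * p y)"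

lemma bdd_below_tilt:
  assumes "sublinear p"
  shows "bdd_below ((\<lambda>t. p (x + t *\<^sub>R y) - t * p y) ` {0..})"
proof (intro bdd_belowI2)
  fix t :: real
  assume "t \<in> {0..}"
  then have "t * p y = p ((x + t *\<^sub>R y) + - x)"
    using sublinear_scaleR[OF assms] by simp
  also have "\<dots> \<le> p (x + t *\<^sub>R y) + p (- x)"
    by (rule sublinear_add[OF assms])
  finally show "- p (- x) \<le> p (x + t *\<^sub>R y) - t * p y" by simp
qed

lemma tilt_le:
  assumes "sublinear p" and "0 \<le> t"
  shows "tilt y p x \<le> p (x + t *\<^sub>R y) - t * p y"
  unfolding tilt_def by (rule cINF_lower[OF bdd_below_tilt[OF assms(1)]]) (simp add: assms(2))

lemma sublinear_tilt:
  assumes p: "sublinear p"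
  shows "sublinear (tilt y p)"
proof -
  have "sublinear (\<lambda>x. INF t\<in>{0..}. p (x + t *\<^sub>R y) - t * p y)"
  proof (rule sublinear_INF)
    show "bdd_below ((\<lambda>t. p (x + t *\<^sub>R y) - t * p y) ` {0..})" for x
      by (rule bdd_below_tilt[OF p])
    show "\<exists>k\<in>{0..}. p (x + x' + k *\<^sub>R y) - k * p y
        \<le> p (x + t *\<^sub>R y) - t * p y + (p (x' + s *\<^sub>R y) - s * p y)"
      if "t \<in> {0..}" "s \<in> {0..}" for t s x x'
      using that sublinear_add[OF p, of "x + t *\<^sub>R y" "x' + s *\<^sub>R y"]
      by (intro bexI[of _ "t + s"]) (auto simp: algebra_simps)
    show "\<exists>k\<in>{0..}. p (r *\<^sub>R x + k *\<^sub>R y) - k * p y \<le> r * (p (x + t *\<^sub>R y) - t * p y)"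
      if "t \<in> {0..}" "0 < r" for t r x
      using that sublinear_scaleR[OF p, of r "x + t *\<^sub>R y"]
      by (intro bexI[of _ "r * t"]) (auto simp: algebra_simps)
  qed simp
  then show ?thesis unfolding tilt_def[abs_def] .
qed

text \<open>
  Zorn's lemma applies because a sublinear \<open>q \<le> p\<close> satisfies \<open>q x \<ge> - q (- x) \<ge> - p (- x)\<close>: this bound
  is independent of \<open>q\<close>, so the pointwise infimum of a chain is finite.
\<close>

lemma exists_minimal_sublinear:
  assumes p: "sublinear (p :: 'a::real_vector \<Rightarrow> real)"
  obtains m where "sublinear m" "m \<le> p" "\<And>q. sublinear q \<Longrightarrow> q \<le> m \<Longrightarrow> q = m"
proof -
  define A where "A = {q. sublinear q \<and> q \<le> p}"
  have "\<exists>m\<in>A. \<forall>q\<in>A. m \<ge> q \<longrightarrow> q = m"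
  proof (rule predicate_Zorn)
    show "partial_order_on A (relation_of (\<ge>) A)"
      by (rule partial_order_on_relation_ofI) auto
    fix C
    assume "C \<in> Chains (relation_of (\<ge>) A)"
    then have CA: "C \<subseteq> A" and tot: "\<And>q q'. q \<in> C \<Longrightarrow> q' \<in> C \<Longrightarrow> q \<le> q' \<or> q' \<le> q"
      by (auto simp: Chains_def relation_of_def)
    show "\<exists>l\<in>A. \<forall>q\<in>C. q \<ge> l"
    proof (cases "C = {}")
      case True
      then show ?thesis using p by (auto simp: A_def)
    next
      case False
      define l where "l x = (INF q\<in>C. q x)" for x
      have bdd: "bdd_below ((\<lambda>q. q x) ` C)" for x
      proof (rule bdd_belowI2)
        fix q
        assume "q \<in> C"
        then have "sublinear q" "q (- x) \<le> p (- x)"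
          using CA by (auto simp: A_def le_fun_def)
        then show "- p (- x) \<le> q x"
          using sublinear_ge_minus[of q x] by simp
      qed
      have "sublinear l"
        unfolding l_def[abs_def]
      proof (rule sublinear_INF[OF False bdd])
        fix q q' x y
        assume C: "q \<in> C" "q' \<in> C"
        then have sub: "sublinear q" "sublinear q'" using CA by (auto simp: A_def)
        from tot[OF C] show "\<exists>k\<in>C. k (x + y) \<le> q x + q' y"
        proof
          assume "q \<le> q'"
          then have "q y \<le> q' y" by (rule le_funD)
          with sublinear_add[OF sub(1), of x y] C(1) show ?thesis
            by (intro bexI[of _ q]) auto
        next
          assume "q' \<le> q"
          then have "q' x \<le> q x" by (rule le_funD)
          with sublinear_add[OF sub(2), of x y] C(2) show ?thesis
            by (intro bexI[of _ q']) auto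
        qed
      next
        fix q r x
        assume "q \<in> C" "0 < (r::real)"
        then show "\<exists>k\<in>C. k (r *\<^sub>R x) \<le> r * q x"
          using CA by (auto simp: A_def sublinear_def)
      qed
      moreover have l_le: "l \<le> q" if "q \<in> C" for q
        unfolding l_def using that bdd by (auto intro!: le_funI cINF_lower)
      moreover obtain q where "q \<in> C" using False by blast
      ultimately have "l \<in> A"
        using CA by (force simp: A_def intro: order_trans)
      with l_le show ?thesis by auto
    qed
  qed
  then show ?thesis
    by (auto simp: A_def intro: order_trans that)
qed

text \<open>
  Tilting a minimal \<open>m\<close> along \<open>y\<close> gives back \<open>m\<close>, so \<open>m x \<le> m (x + y) - m y\<close>. This is the
  reverse of subadditivity.
\<close>

lemma linear_minimal_sublinear:
  assumes m: "sublinear m" and min: "\<And>q. sublinear q \<Longrightarrow> q \<le> m \<Longrightarrow> q = m"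
  shows "linear m"
proof -
  have add: "m (x + y) = m x + m y" for x y
  proof -
    have "tilt y m = m"
      using tilt_le[OF m, of 0 y] by (intro min sublinear_tilt[OF m] le_funI) simp
    then have "m x \<le> m (x + y) - m y"
      using tilt_le[OF m, of 1 y x] by simp
    then show ?thesis using sublinear_add[OF m, of x y] by simp
  qed
  have minus: "m (- x) = - m x" for x
    using add[of x "- x"] sublinear_scaleR[OF m, of 0 0] by simp
  have "m (r *\<^sub>R x) = r * m x" for r x
    using sublinear_scaleR[OF m, of r x] sublinear_scaleR[OF m, of "- r" x] minus[of "r *\<^sub>R x"]
    by (cases "0 \<le> r") auto
  with add show ?thesis by (intro linearI) auto
qed

text \<open>
  Only the value at \<open>a\<close> needs care. A minimal functional below \<open>p\<close> may be smaller than \<open>p\<close> at \<open>a\<close>;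
  below the tilt of \<open>p\<close> along \<open>a\<close> it is at most \<open>- p a\<close> at \<open>- a\<close>, hence by linearity at least \<open>p a\<close> at \<open>a\<close>.
\<close>

theorem real_Hahn_Banach:
  assumes p: "sublinear p"
  obtains g where "linear g" "\<And>x. g x \<le> p x" "g a = p a"
proof -
  obtain m where m: "sublinear m" "m \<le> tilt a p"
    and min: "\<And>q. sublinear q \<Longrightarrow> q \<le> m \<Longrightarrow> q = m"
    using exists_minimal_sublinear[OF sublinear_tilt[OF p, of a]] by blast
  have lin: "linear m" using linear_minimal_sublinear[OF m(1) min] .
  have le: "m x \<le> p x" for x
    using le_funD[OF m(2), of x] tilt_le[OF p, of 0 a x] by simp
  have "m (- a) \<le> - p a"
    using le_funD[OF m(2), of "- a"] tilt_le[OF p, of 1 a "- a"] sublinear_scaleR[OF p, of 0 0]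
    by simp
  then have "m a = p a"
    using le[of a] linear_neg[OF lin, of a] by simp
  with lin le show ?thesis using that by blast
qed

section \<open>Norming functionals over the scalar field\<close>

text \<open>
  The isomorphism \<open>\<phi>\<close> with a subfield of the complex numbers decides between two constructions from
  a real norming functional \<open>g\<close>: the coerced \<open>g\<close> itself over the reals, and \<open>g x - \<i> g (\<i> x)\<close> over
  the complex numbers. The latter has real part \<open>g\<close>, so its norm at \<open>a\<close> is at least \<open>g a\<close>.
\<close>

lemma (in banach_over) exists_norming_functional:
  fixes a :: 'e
  obtains f where "Vector_Spaces.linear scale (*) f" "\<And>x. norm (f x) \<le> norm x" "norm (f a) = norm a"
proof -
  have "sublinear (norm :: 'e \<Rightarrow> real)"
    by (simp add: sublinear_def norm_triangle_ineq)
  then obtain g :: "'e \<Rightarrow> real"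
    where g: "linear g" and g_le: "\<And>x. g x \<le> norm x" and g_a: "g a = norm a"
    using real_Hahn_Banach[of norm a] by blast
  have g_add: "g (x + y) = g x + g y" and g_scaleR: "g (r *\<^sub>R x) = r * g x" for x y r
    using linear_add[OF g] linear_scale[OF g] by auto
  have g_abs: "\<bar>g x\<bar> \<le> norm x" for x
    using g_le[of x] g_le[of "- x"] linear_neg[OF g, of x] by simp
  obtain \<phi> :: "'k \<Rightarrow> complex"
    where \<phi>_add: "\<And>a b. \<phi> (a + b) = \<phi> a + \<phi> b"
      and \<phi>_mult: "\<And>a b. \<phi> (a * b) = \<phi> a * \<phi> b"
      and \<phi>_scaleR: "\<And>r a. \<phi> (r *\<^sub>R a) = r *\<^sub>R \<phi> a"
      and \<phi>_norm: "\<And>a. norm (\<phi> a) = norm a"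
      and \<phi>_range: "range \<phi> = \<real> \<or> range \<phi> = UNIV"
    using real_or_complex by blast
  have \<phi>_1: "\<phi> 1 = 1"
  proof -
    have "\<phi> 1 * \<phi> 1 = \<phi> 1 * 1" using \<phi>_mult[of 1 1] by simp
    moreover have "\<phi> 1 \<noteq> 0" using \<phi>_norm[of 1] by auto
    ultimately show ?thesis using mult_left_cancel by blast
  qed
  have \<phi>_of_real: "\<phi> (of_real r) = of_real r" for r
    using \<phi>_scaleR[of r 1] by (simp add: \<phi>_1 of_real_def)
  have \<phi>_eq: "a = b" if "\<phi> a = \<phi> b" for a b
  proof -
    have "\<phi> (a - b) + \<phi> b = \<phi> a" using \<phi>_add[of "a - b" b] by simp
    with that have "\<phi> (a - b) = 0" by simp
    with \<phi>_norm[of "a - b"] show ?thesis by simp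
  qed
  have linI: "Vector_Spaces.linear scale (*) f"
    if "\<And>x y. f (x + y) = f x + f y" "\<And>c x. f (scale c x) = c * f x" for f
    by unfold_locales (use that in \<open>auto simp: algebra_simps\<close>)
  from \<phi>_range show ?thesis
  proof
    assume R: "range \<phi> = \<real>"
    have real: "\<exists>r. c = of_real r" for c :: 'k
    proof -
      have "\<phi> c \<in> \<real>" using R by auto
      then obtain r where "\<phi> c = of_real r" by (auto elim: Reals_cases)
      with \<phi>_eq[of c "of_real r"] show ?thesis by (auto simp: \<phi>_of_real)
    qed
    show ?thesis
    proof (rule that[of "\<lambda>x. of_real (g x)"])
      show "Vector_Spaces.linear scale (*) (\<lambda>x. of_real (g x))"
      proof (rule linI)
        show "of_real (g (scale c x)) = c * of_real (g x)" for c x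
          using real[of c] by (auto simp: scale_of_real g_scaleR)
      qed (simp add: g_add)
    qed (simp_all add: g_abs g_a)
  next
    assume U: "range \<phi> = UNIV"
    then obtain i where i: "\<phi> i = \<i>" by (metis rangeE UNIV_I)
    define f where "f x = of_real (g x) - i * of_real (g (scale i x))" for x
    have \<phi>_minus: "\<phi> (b - c) = \<phi> b - \<phi> c" for b c
      using \<phi>_add[of "b - c" c] by simp
    have \<phi>_f: "\<phi> (f x) = Complex (g x) (- g (scale i x))" for x
      by (simp add: f_def \<phi>_minus \<phi>_mult \<phi>_of_real i complex_eq_iff)
    have f_scale: "f (scale c x) = c * f x" for c x
    proof (rule \<phi>_eq)
      define r s where "r = Re (\<phi> c)" and "s = Im (\<phi> c)"
      have c: "c = of_real r + of_real s * i"
        by (rule \<phi>_eq) (simp add: \<phi>_add \<phi>_mult \<phi>_of_real i r_def s_def complex_eq_iff)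
      have ii: "i * i = - 1"
        by (rule \<phi>_eq) (use \<phi>_minus[of 0 1] \<phi>_of_real[of 0] in \<open>simp add: \<phi>_mult i \<phi>_1\<close>)
      have cx: "scale c x = r *\<^sub>R x + s *\<^sub>R scale i x"
        by (simp add: c scale_left_distrib scale_of_real flip: scale_scale)
      have "scale i (scale i x) = - x"
        by (simp add: ii)
      then have icx: "scale i (scale c x) = r *\<^sub>R scale i x - s *\<^sub>R x"
        by (simp add: cx scale_right_distrib scale_scaleR)
      show "\<phi> (f (scale c x)) = \<phi> (c * f x)"
        unfolding \<phi>_f \<phi>_mult icx unfolding cx
        by (simp add: complex_eq_iff g_add g_scaleR linear_diff[OF g] r_def s_def algebra_simps
            del: scale_scale)
    qed
    have f_add: "f (x + y) = f x + f y" for x y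
      by (simp add: f_def g_add scale_right_distrib algebra_simps)
    have f_le: "norm (f x) \<le> norm x" for x
    proof (cases "f x = 0")
      case False
      \<comment> \<open>Rotate \<open>x\<close> by a unimodular scalar that makes the value of \<open>f\<close> real and positive, so that
        this value is one of \<open>g\<close>.\<close>
      define c where "c = of_real (norm (f x)) / f x"
      have "norm c = 1" using False by (simp add: c_def norm_divide)
      have "f (scale c x) = of_real (norm (f x))"
        using False by (simp add: f_scale c_def)
      then have "norm (f x) = g (scale c x)"
        using \<phi>_f[of "scale c x"] by (simp add: \<phi>_of_real complex_eq_iff)
      also have "\<dots> \<le> norm x"
        using g_le[of "scale c x"] \<open>norm c = 1\<close> by (simp add: norm_scale)
      finally show ?thesis .
    qed simp
    have "norm a = Re (\<phi> (f a))"
      by (simp add: \<phi>_f g_a)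
    also have "\<dots> \<le> norm (f a)"
      using complex_Re_le_cmod[of "\<phi> (f a)"] by (simp only: \<phi>_norm)
    finally have "norm a \<le> norm (f a)" .
    with f_le[of a] have "norm (f a) = norm a" by simp
    with linI[OF f_add f_scale] f_le show ?thesis using that by blast
  qed
qed

section \<open>Rank-one operators\<close>

definition rank_one ::
    "('k \<Rightarrow> 'f::banach \<Rightarrow> 'f) \<Rightarrow> ('e::banach \<Rightarrow> 'k::real_or_complex) \<Rightarrow> 'f \<Rightarrow> ('e \<Rightarrow>\<^sub>L 'f)" where
  "rank_one scaleF f y = Blinfun (\<lambda>x. scaleF (f x) y)"

lemma rank_one_apply:
  assumes E: "banach_over scaleE" and F: "banach_over scaleF"
    and lin: "Vector_Spaces.linear scaleE (*) f" and le: "\<And>x. norm (f x) \<le> norm x"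
  shows "blinfun_apply (rank_one scaleF f y) x = scaleF (f x) y"
proof -
  interpret E: banach_over scaleE by fact
  interpret F: banach_over scaleF by fact
  interpret f: Vector_Spaces.linear scaleE "(*)" f by fact
  have "bounded_linear (\<lambda>x. scaleF (f x) y)"
  proof (rule bounded_linear_intro[where K = "norm y"])
    show "scaleF (f (r *\<^sub>R x)) y = r *\<^sub>R scaleF (f x) y" for r x
      using f.scale[of "of_real r" x] F.scale_of_real[of r "scaleF (f x) y"]
      by (simp add: E.scale_of_real)
    show "norm (scaleF (f x) y) \<le> norm x * norm y" for x
      by (simp add: F.norm_scale mult_right_mono le)
  qed (simp add: f.add F.scale_left_distrib)
  then show ?thesis by (simp add: rank_one_def bounded_linear_Blinfun_apply)
qed

text \<open>
  The norm at \<open>a\<close> is \<open>\<bar>f a\<bar> \<parallel>y\<parallel> = \<parallel>y\<parallel>\<close>, and no vector of norm one does better since \<open>\<bar>f x\<bar> \<le> \<parallel>x\<parallel>\<close>.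
\<close>

lemma rank_one_norm_attaining:
  assumes E: "banach_over scaleE" and F: "banach_over scaleF"
    and lin: "Vector_Spaces.linear scaleE (*) f" and le: "\<And>x. norm (f x) \<le> norm x"
    and a: "norm a = 1" "norm (f a) = 1"
  shows "rank_one scaleF f y \<in> norm_attaining_at scaleE scaleF a"
proof -
  interpret E: banach_over scaleE by fact
  interpret F: banach_over scaleF by fact
  interpret f: Vector_Spaces.linear scaleE "(*)" f by fact
  note app = rank_one_apply[OF E F lin le]
  have "norm (rank_one scaleF f y) \<le> norm y"
    by (rule norm_blinfun_bound) (simp_all add: app F.norm_scale mult.commute[of "norm y"] mult_right_mono le)
  moreover have "norm (blinfun_apply (rank_one scaleF f y) a) = norm y"
    by (simp add: app F.norm_scale a)
  moreover have "norm (blinfun_apply (rank_one scaleF f y) a) \<le> norm (rank_one scaleF f y)"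
    using norm_blinfun[of "rank_one scaleF f y" a] a by simp
  moreover have "Vector_Spaces.linear scaleE scaleF (blinfun_apply (rank_one scaleF f y))"
    by unfold_locales (simp_all add: app f.add f.scale F.scale_left_distrib)
  ultimately show ?thesis by (simp add: norm_attaining_at_def)
qed

lemma linear_rank_one:
  fixes scaleE :: "'k::real_or_complex \<Rightarrow> 'e::banach \<Rightarrow> 'e"
    and scaleF :: "'k \<Rightarrow> 'f::banach \<Rightarrow> 'f"
  assumes E: "banach_over scaleE" and F: "banach_over scaleF"
    and lin: "Vector_Spaces.linear scaleE (*) f" and le: "\<And>x. norm (f x) \<le> norm x"
  shows "Vector_Spaces.linear scaleF (scale_blinfun scaleF) (rank_one scaleF f)"
proof -
  interpret F: banach_over scaleF by fact
  interpret L: vector_space "scale_blinfun scaleF :: 'k \<Rightarrow> ('e \<Rightarrow>\<^sub>L 'f) \<Rightarrow> _"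
    by (rule F.vector_space_scale_blinfun)
  note app = rank_one_apply[OF E F lin le]
  show ?thesis
    by unfold_locales
      (auto intro!: blinfun_eqI simp: app blinfun.add_left F.blinfun_apply_scale_blinfun
        F.scale_right_distrib mult.commute)
qed

section \<open>Continuum many independent vectors in a copy of \<open>\<ell>\<^sub>q\<close>\<close>

lemma lq_add:
  fixes x y :: "nat \<Rightarrow> 'k::real_or_complex"
  assumes q: "0 < q" and "x \<in> lq q" "y \<in> lq q"
  shows "(\<lambda>n. x n + y n) \<in> lq q"
proof -
  have le: "norm (x n + y n) powr q \<le> 2 powr q * (norm (x n) powr q + norm (y n) powr q)" for n
  proof -
    have "norm (x n + y n) \<le> 2 * max (norm (x n)) (norm (y n))"
      using norm_triangle_ineq[of "x n" "y n"] by linarith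
    then have "norm (x n + y n) powr q \<le> (2 * max (norm (x n)) (norm (y n))) powr q"
      using q by (intro powr_mono2) auto
    also have "\<dots> = 2 powr q * max (norm (x n)) (norm (y n)) powr q"
      by (simp add: powr_mult)
    also have "max (norm (x n)) (norm (y n)) powr q \<le> norm (x n) powr q + norm (y n) powr q"
      by (simp add: max_def)
    finally show ?thesis by simp
  qed
  have "summable (\<lambda>n. 2 powr q * (norm (x n) powr q + norm (y n) powr q))"
    using assms by (intro summable_mult summable_add) (simp_all add: lq_def)
  then have "summable (\<lambda>n. norm (x n + y n) powr q)"
    by (rule summable_comparison_test') (simp add: le)
  then show ?thesis by (simp add: lq_def)
qed

lemma lq_mult: "x \<in> lq q \<Longrightarrow> (\<lambda>n. c * x n) \<in> lq q"
  by (simp add: lq_def norm_mult powr_mult summable_mult)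

lemma geometric_in_lq:
  assumes "0 < q" "0 < r" "r < 1"
  shows "(\<lambda>n. of_real r ^ n) \<in> lq q"
proof -
  have "norm (of_real r ^ n :: 'a) powr q = (r powr q) ^ n" for n
    using assms by (simp add: norm_power powr_powr mult.commute flip: powr_realpow)
  moreover have "r powr q < 1"
    using assms powr_less_mono2[of q r 1] by simp
  ultimately show ?thesis by (simp add: lq_def summable_geometric)
qed

text \<open>
  The relation extends from powers to \<open>\<Sum>r\<in>S. c r * p r = 0\<close> for every polynomial \<open>p\<close>. A polynomial
  whose zero set is \<open>S\<close> without \<open>r\<close> isolates \<open>c r\<close>.
\<close>

lemma power_sums_zero_imp_coeffs_zero:
  fixes c :: "'a::field \<Rightarrow> 'a"
  assumes S: "finite S" and zero: "\<And>n. (\<Sum>r\<in>S. c r * r ^ n) = 0" and r: "r \<in> S"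
  shows "c r = 0"
proof -
  have poly_zero: "(\<Sum>r\<in>S. c r * poly p r) = 0" for p
  proof -
    have "(\<Sum>r\<in>S. c r * poly p r) = (\<Sum>r\<in>S. \<Sum>i\<le>degree p. coeff p i * (c r * r ^ i))"
      by (simp add: poly_altdef sum_distrib_left algebra_simps)
    also have "\<dots> = (\<Sum>i\<le>degree p. coeff p i * (\<Sum>r\<in>S. c r * r ^ i))"
      by (subst sum.swap) (simp add: sum_distrib_left)
    finally show ?thesis by (simp add: zero)
  qed
  define p where "p = (\<Prod>s\<in>S - {r}. [:- s, 1:])"
  have p: "poly p t = (\<Prod>s\<in>S - {r}. t - s)" for t
    by (simp add: p_def poly_prod)
  have "0 = (\<Sum>t\<in>S. c t * poly p t)" by (simp add: poly_zero)
  also have "\<dots> = c r * poly p r + (\<Sum>t\<in>S - {r}. c t * poly p t)"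
    by (rule sum.remove[OF S r])
  also have "(\<Sum>t\<in>S - {r}. c t * poly p t) = 0"
    by (rule sum.neutral) (auto simp: p S prod_zero_iff)
  finally have "c r * poly p r = 0" by simp
  moreover have "poly p r \<noteq> 0" using S by (auto simp: p prod_zero_iff)
  ultimately show ?thesis by simp
qed

text \<open>
  Independence of the set \<open>w ` I\<close> alone would say nothing about its size. The relations are therefore
  indexed by \<open>I\<close>: a repeated vector would give the nontrivial relation \<open>w i - w j = 0\<close>.
\<close>

lemma (in vector_space) independent_indexed_image:
  assumes zero: "\<And>S c i. finite S \<Longrightarrow> S \<subseteq> I \<Longrightarrow> (\<Sum>i\<in>S. scale (c i) (w i)) = 0 \<Longrightarrow> i \<in> S \<Longrightarrow> c i = 0"
  shows "inj_on w I" and "independent (w ` I)"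
proof -
  show inj: "inj_on w I"
  proof (rule inj_onI, rule ccontr)
    fix i j
    assume ij: "i \<in> I" "j \<in> I" "w i = w j" "i \<noteq> j"
    define c where "c k = (if k = i then 1 else - 1 :: 'a)" for k
    have "(\<Sum>k\<in>{i, j}. scale (c k) (w k)) = 0"
      using ij by (simp add: c_def)
    then have "c i = 0"
      using ij by (intro zero[of "{i, j}"]) auto
    then show False by (simp add: c_def)
  qed
  show "independent (w ` I)"
    unfolding independent_explicit_module
  proof (intro allI impI)
    fix t u v
    assume t: "finite t" "t \<subseteq> w ` I" and sum: "(\<Sum>v\<in>t. scale (u v) v) = 0" and v: "v \<in> t"
    obtain S where S: "S \<subseteq> I" "finite S" "t = w ` S"
      using finite_subset_image[OF t] by blast
    then have "(\<Sum>i\<in>S. scale (u (w i)) (w i)) = 0"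
      using sum inj by (simp add: sum.reindex inj_on_subset)
    then show "u v = 0"
      using zero[of S "u \<circ> w"] S v by auto
  qed
qed

lemma lq_norm_eq_0_imp:
  assumes "x \<in> lq q" "lq_norm q x = 0"
  shows "x n = 0"
proof -
  have "(\<Sum>n. norm (x n) powr q) = 0"
    using assms(2) by (simp add: lq_norm_def)
  then have "norm (x n) powr q = 0"
    using assms(1) suminf_eq_zero_iff[of "\<lambda>n. norm (x n) powr q"] by (simp add: lq_def)
  then show ?thesis by simp
qed

lemma independent_continuum_of_lq_copy:
  fixes scaleF :: "'k::real_or_complex \<Rightarrow> 'f::banach \<Rightarrow> 'f"
  assumes F: "banach_over scaleF" and q: "0 < q" and copy: "contains_isometric_copy_lq scaleF q"
  obtains B where "\<not> module.dependent scaleF B" "B \<approx> (UNIV :: real set)"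
proof -
  interpret F: banach_over scaleF by fact
  obtain T :: "(nat \<Rightarrow> 'k) \<Rightarrow> 'f"
    where T_add: "\<And>x y. x \<in> lq q \<Longrightarrow> y \<in> lq q \<Longrightarrow> T (\<lambda>n. x n + y n) = T x + T y"
      and T_scale: "\<And>a x. x \<in> lq q \<Longrightarrow> T (\<lambda>n. a * x n) = scaleF a (T x)"
      and T_norm: "\<And>x. x \<in> lq q \<Longrightarrow> norm (T x) = lq_norm q x"
    using copy unfolding contains_isometric_copy_lq_def by blast
  define e :: "real \<Rightarrow> nat \<Rightarrow> 'k" where "e r n = of_real r ^ n" for r n
  have e: "e r \<in> lq q" if "r \<in> {0<..<1}" for r
    using that geometric_in_lq[OF q, of r] by (simp add: e_def[abs_def])
  have zero: "(\<lambda>n. 0) \<in> lq q" by (simp add: lq_def)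
  have T_sum: "(\<lambda>n. \<Sum>r\<in>S. c r * e r n) \<in> lq q \<and>
      T (\<lambda>n. \<Sum>r\<in>S. c r * e r n) = (\<Sum>r\<in>S. scaleF (c r) (T (e r)))"
    if "finite S" "S \<subseteq> {0<..<1}" for S c
    using that
  proof (induction S rule: finite_induct)
    case empty
    then show ?case using zero T_scale[OF zero, of 0] by simp
  next
    case (insert r S)
    have r: "e r \<in> lq q" using insert.prems e by simp
    show ?case
      using insert lq_add[OF q lq_mult[OF r, of "c r"]] T_add[OF lq_mult[OF r, of "c r"]]
        T_scale[OF r, of "c r"]
      by simp
  qed
  have indep: "c r = 0"
    if S: "finite S" "S \<subseteq> {0<..<1}" and sum: "(\<Sum>r\<in>S. scaleF (c r) (T (e r))) = 0" and r: "r \<in> S"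
    for S c r
  proof -
    have "(\<Sum>r\<in>S. c r * e r n) = 0" for n
    proof (rule lq_norm_eq_0_imp)
      show "(\<lambda>n. \<Sum>r\<in>S. c r * e r n) \<in> lq q"
        using T_sum[OF S] by blast
      then show "lq_norm q (\<lambda>n. \<Sum>r\<in>S. c r * e r n) = 0"
        using T_sum[OF S, of c] T_norm[of "\<lambda>n. \<Sum>r\<in>S. c r * e r n"] sum by simp
    qed
    \<comment> \<open>The nodes of the power sums lie in the scalar field, so the coefficients are transported along
      the embedding of the reals.\<close>
    moreover have inj: "inj_on (of_real :: real \<Rightarrow> 'k) S"
      by (simp add: inj_on_def)
    ultimately have "(\<Sum>s\<in>of_real ` S. c (inv_into S of_real s) * s ^ n) = 0" for n
      by (simp add: sum.reindex inv_into_f_f e_def)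
    then have "c (inv_into S of_real (of_real r :: 'k)) = 0"
      using S r
      by (intro power_sums_zero_imp_coeffs_zero[of "of_real ` S" "\<lambda>s. c (inv_into S of_real s)"]) auto
    then show ?thesis using inj r by (simp add: inv_into_f_f)
  qed
  have inj: "inj_on (\<lambda>r. T (e r)) {0<..<1}"
    by (rule F.independent_indexed_image(1)) (rule indep)
  have ind: "F.independent ((\<lambda>r. T (e r)) ` {0<..<1})"
    by (rule F.independent_indexed_image(2)) (rule indep)
  from inj have "(\<lambda>r. T (e r)) ` {0<..<1} \<approx> {0<..<1::real}"
    by (simp add: inj_on_image_eqpoll_self)
  also have "{0<..<1::real} \<approx> (UNIV :: real set)"
    by (simp add: open_interval_eqpoll_reals)
  finally show ?thesis using ind that by blast
qed

section \<open>Lineability\<close>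

theorem proposition2p1:
  fixes scaleE :: "'k::real_or_complex \<Rightarrow> 'e::banach \<Rightarrow> 'e"
    and scaleF :: "'k \<Rightarrow> 'f::banach \<Rightarrow> 'f"
    and x0 :: 'e and q :: real
  assumes "banach_over scaleE" and "banach_over scaleF"
    and "1 \<le> q" and "contains_isometric_copy_lq scaleF q"
    and "norm x0 = 1"
  shows "vector_space.c_lineable (scale_blinfun scaleF) (norm_attaining_at scaleE scaleF x0)"
proof -
  interpret E: banach_over scaleE by fact
  interpret F: banach_over scaleF by fact
  interpret L: vector_space "scale_blinfun scaleF :: 'k \<Rightarrow> ('e \<Rightarrow>\<^sub>L 'f) \<Rightarrow> _"
    by (rule F.vector_space_scale_blinfun)
  obtain f where f: "Vector_Spaces.linear scaleE (*) f" "\<And>x. norm (f x) \<le> norm x"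
      and fx0: "norm (f x0) = 1"
    using E.exists_norming_functional[of x0] \<open>norm x0 = 1\<close> by metis
  let ?\<Phi> = "rank_one scaleF f"
  interpret \<Phi>: Vector_Spaces.linear scaleF "scale_blinfun scaleF" ?\<Phi>
    by (rule linear_rank_one[OF assms(1,2) f])
  have attain: "?\<Phi> y \<in> norm_attaining_at scaleE scaleF x0" for y
    by (rule rank_one_norm_attaining[OF assms(1,2) f assms(5) fx0])
  have inj: "inj ?\<Phi>"
  proof (rule injI)
    fix y z
    assume "?\<Phi> y = ?\<Phi> z"
    then have "scaleF (f x0) y = scaleF (f x0) z"
      using rank_one_apply[OF assms(1,2) f] by metis
    moreover have "f x0 \<noteq> 0" using fx0 by auto
    ultimately show "y = z" by simp
  qed
  obtain B where B: "F.independent B" "B \<approx> (UNIV :: real set)"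
    using independent_continuum_of_lq_copy[OF assms(2) _ assms(4)] \<open>1 \<le> q\<close> by auto
  have "L.independent (?\<Phi> ` B)"
    using B(1) inj by (intro \<Phi>.independent_injective_image) (auto intro: inj_on_subset)
  moreover have "L.span (?\<Phi> ` B) \<subseteq> norm_attaining_at scaleE scaleF x0 \<union> {0}"
    using attain by (auto simp: \<Phi>.span_image)
  moreover have "?\<Phi> ` B \<approx> (UNIV :: real set)"
    using inj_on_image_eqpoll_self[of ?\<Phi> B] inj B(2) by (meson eqpoll_trans inj_on_subset subset_UNIV)
  ultimately show ?thesis
    unfolding L.c_lineable_def using L.subspace_span by blast
qed

end
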